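(* Let $G$ be a graph whose complement $\overline{G}$ is connected with $diam(\overline{G})>3$. Then $G$ is connected and $trc(G)\leq 7$.
   Context: All graphs are finite, simple and undirected. A total-coloring assigns colors to all vertices and edges; a path is total-rainbow if its edges and internal vertices receive pairwise distinct colors; $trc(G)$ is the minimum number of colors in a total-coloring of the connected graph $G$ such that every two distinct vertices are joined by a total-rainbow path. *)

theory Defs
  imports "Graph_Theory.Graph_Theory"
begin

text \<open>
  A finite simple undirected graph is a \<^term>\<open>pair_graph\<close>: a finite, loop-free digraph with a
  symmetric arc set. The undirected edge joining \<open>u\<close> and \<open>v\<close> is the unordered pair \<open>{u, v}\<close>.
\<close>

definition graph_complement :: "'a pair_pre_digraph \<Rightarrow> 'a pair_pre_digraph" where
  "graph_complement G =
     \<lparr> pverts = pverts G,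
       parcs = {(u, v). u \<in> pverts G \<and> v \<in> pverts G \<and> u \<noteq> v \<and> (u, v) \<notin> parcs G} \<rparr>"

definition graph_dist :: "'a pair_pre_digraph \<Rightarrow> 'a \<Rightarrow> 'a \<Rightarrow> ereal" where
  "graph_dist G u v = wf_digraph.\<mu> (with_proj G) (\<lambda>_. 1) u v"

definition graph_diam :: "'a pair_pre_digraph \<Rightarrow> ereal" where
  "graph_diam G = (SUP u\<in>pverts G. SUP v\<in>pverts G. graph_dist G u v)"

definition graph_edges :: "'a pair_pre_digraph \<Rightarrow> 'a set set" where
  "graph_edges G = {{u, v} | u v. (u, v) \<in> parcs G}"

text \<open>
  A total-coloring is a function on the disjoint sum of vertices (\<^term>\<open>Inl\<close>) and edges
  (\<^term>\<open>Inr\<close>); only its values on the following set matter.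
\<close>

definition graph_elements :: "'a pair_pre_digraph \<Rightarrow> ('a + 'a set) set" where
  "graph_elements G = Inl ` pverts G \<union> Inr ` graph_edges G"

definition total_rainbow_path ::
    "'a pair_pre_digraph \<Rightarrow> ('a + 'a set \<Rightarrow> nat) \<Rightarrow> 'a list \<Rightarrow> bool" where
  "total_rainbow_path G c p \<longleftrightarrow>
     vpath p (with_proj G) \<and>
     distinct (map (\<lambda>(u, v). c (Inr {u, v})) (vwalk_arcs p) @
               map (\<lambda>w. c (Inl w)) (butlast (tl p)))"

definition total_rainbow_connected ::
    "'a pair_pre_digraph \<Rightarrow> ('a + 'a set \<Rightarrow> nat) \<Rightarrow> bool" where
  "total_rainbow_connected G c \<longleftrightarrow>
     (\<forall>u\<in>pverts G. \<forall>v\<in>pverts G. u \<noteq> v \<longrightarrow>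
        (\<exists>p. total_rainbow_path G c p \<and> hd p = u \<and> last p = v))"

text \<open>Meaningful for connected finite graphs only: otherwise no such coloring exists.\<close>

definition trc :: "'a pair_pre_digraph \<Rightarrow> nat" where
  "trc G = (LEAST k. \<exists>c. total_rainbow_connected G c \<and> card (c ` graph_elements G) = k)"

end

theory Submission
  imports Defs
begin

text \<open>
  Choose \<open>x\<close> of eccentricity at least \<open>4\<close> in the complement and let \<open>V\<^sub>i\<close> (\<open>i < 4\<close>) be the vertices
  at distance \<open>i\<close> from \<open>x\<close> there, and \<open>V\<^sub>4\<close> those at distance at least \<open>4\<close>. Vertices in layers whose
  indices differ by at least \<open>2\<close> are adjacent in \<open>G\<close>. Color each vertex by its layer and each edge by
  the layers of its endpoints. Two vertices of \<open>V\<^sub>1\<close> can be joined through \<open>V\<^sub>3\<close>, \<open>x\<close>, \<open>V\<^sub>4\<close>; making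
  this path total-rainbow takes all seven colors, and the other layers and layer pairs can reuse
  these colors.
\<close>

section \<open>Reversal of walks and of total-rainbow paths\<close>

lemma vwalk_arcs_snoc: "p \<noteq> [] \<Longrightarrow> vwalk_arcs (p @ [v]) = vwalk_arcs p @ [(last p, v)]"
  by (induction p rule: vwalk_arcs.induct) auto

lemma vwalk_arcs_rev: "vwalk_arcs (rev p) = rev (map prod.swap (vwalk_arcs p))"
proof (induction p rule: vwalk_arcs.induct)
  case (3 x y xs)
  then show ?case using vwalk_arcs_snoc[of "rev xs @ [y]" x] by simp
qed simp_all

text \<open>Edge colors depend on unordered pairs only, so reversal just reverses both color lists.
  This lets the case analysis below assume \<open>f u \<le> f v\<close>.\<close>

lemma total_rainbow_path_rev:
  assumes "sym (parcs G)" and "total_rainbow_path G c p"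
  shows "total_rainbow_path G c (rev p)"
proof -
  have "map (\<lambda>(u, v). c (Inr {u, v})) (vwalk_arcs (rev p))
      = rev (map (\<lambda>(u, v). c (Inr {u, v})) (vwalk_arcs p))"
    by (auto simp: vwalk_arcs_rev rev_map insert_commute)
  moreover have "butlast (tl (rev p)) = rev (butlast (tl p))"
    by (metis butlast_rev butlast_tl rev_rev_ident)
  moreover have "vpath (rev p) (with_proj G)"
    using assms unfolding total_rainbow_path_def vpath_def vwalk_def
    by (auto simp: vwalk_arcs_rev dest: symD)
  ultimately show ?thesis
    using assms(2) unfolding total_rainbow_path_def by (simp flip: rev_map)
qed

section \<open>The layer coloring and its rainbow paths\<close>

definition layer_vertex_color :: "nat \<Rightarrow> nat" where
  "layer_vertex_color i = (if i = 0 then 5 else if i = 4 then 6 else 4)"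

text \<open>Edges use colors 0 to 3 and vertices 4 to 6, so the two kinds never clash. The default 0
  serves the layer pairs \<open>{0, 2}\<close> and \<open>{1, 3}\<close>; pairs whose indices differ
  by at most 1 also get it, but the chosen paths avoid them.\<close>

definition layer_edge_color :: "nat set \<Rightarrow> nat" where
  "layer_edge_color S =
     (if S = {0, 3} \<or> S = {2, 4} then 1 else if S = {0, 4} then 2 else if S = {1, 4} then 3 else 0)"

definition layer_coloring :: "('a \<Rightarrow> nat) \<Rightarrow> 'a + 'a set \<Rightarrow> nat" where
  "layer_coloring f = case_sum (\<lambda>v. layer_vertex_color (f v)) (\<lambda>e. layer_edge_color (f ` e))"

lemma layer_coloring_le: "layer_coloring f z \<le> 6"
  by (cases z) (auto simp: layer_coloring_def layer_vertex_color_def layer_edge_color_def)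

text \<open>Every path below moves between layers at least 2 apart, so \<open>adj\<close> supplies
  its edges. Detours run through \<open>a0\<close> and \<open>a4\<close>, whose vertex colors 5 and
  6 are their own, and use at most one internal vertex of color 4.\<close>

lemma layer_coloring_total_rainbow_connected:
  fixes G :: "'a pair_pre_digraph" and f :: "'a \<Rightarrow> nat"
  assumes sym: "sym (parcs G)"
    and le: "\<And>v. v \<in> pverts G \<Longrightarrow> f v \<le> 4"
    and zero: "\<And>u v. u \<in> pverts G \<Longrightarrow> v \<in> pverts G \<Longrightarrow> f u = 0 \<Longrightarrow> f v = 0 \<Longrightarrow> u = v"
    and ex: "\<And>i. i \<le> 4 \<Longrightarrow> \<exists>v\<in>pverts G. f v = i"
    and adj: "\<And>u v. u \<in> pverts G \<Longrightarrow> v \<in> pverts G \<Longrightarrow> f u + 2 \<le> f v \<Longrightarrow> (u, v) \<in> parcs G"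
  shows "total_rainbow_connected G (layer_coloring f)"
proof -
  have adj': "(u, v) \<in> parcs G" if "u \<in> pverts G" "v \<in> pverts G" "f v + 2 \<le> f u" for u v
    using adj[of v u] that sym by (auto dest: symD)
  have neq: "u \<noteq> v" if "f u \<noteq> f v" for u v
    using that by auto
  obtain a0 a1 a2 a3 a4 where a:
    "a0 \<in> pverts G" "a1 \<in> pverts G" "a2 \<in> pverts G" "a3 \<in> pverts G" "a4 \<in> pverts G"
    "f a0 = 0" "f a1 = 1" "f a2 = 2" "f a3 = 3" "f a4 = 4"
    using ex[of 0] ex[of 1] ex[of 2] ex[of 3] ex[of 4] by auto
  have *: "\<exists>p. total_rainbow_path G (layer_coloring f) p \<and> hd p = u \<and> last p = v"
    if uv: "u \<in> pverts G" "v \<in> pverts G" "u \<noteq> v" "f u \<le> f v" for u v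
  proof -
    \<comment> \<open>\<open>neq\<close> separates path vertices by their layers; only the two ends
      can share a layer, and they differ by assumption.\<close>
    note defs = total_rainbow_path_def vpath_def vwalk_def layer_coloring_def
      layer_vertex_color_def layer_edge_color_def doubleton_eq_iff adj adj' neq
    consider "f u + 2 \<le> f v" | "f u = 0" "f v = 1" | "f u = 1" "f v = 1" | "f u = 1" "f v = 2"
      | "f u = 2" "f v = 2" | "f u = 2" "f v = 3" | "f u = 3" "f v = 3" | "f u = 3" "f v = 4"
      | "f u = 4" "f v = 4"
    proof -
      have "f u = 0 \<or> f u = 1 \<or> f u = 2 \<or> f u = 3 \<or> f u = 4" using le[OF uv(1)] by linarith
      moreover have "f u + 2 \<le> f v \<or> f v = f u \<or> f v = Suc (f u)" using uv(4) by linarith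
      \<comment> \<open>Layer 0 is a single vertex and there is no layer 5, which leaves the nine
        cases.\<close>
      moreover have "\<not> (f u = 0 \<and> f v = 0)" "f v \<noteq> 5" using zero[of u v] le[of v] uv by auto
      ultimately show thesis using that by (elim disjE) simp_all
    qed
    then show ?thesis
    proof cases
      case 1
      then show ?thesis
        using uv a by (intro exI[of _ "[u, v]"]) (simp add: defs)
    next
      case 2
      then show ?thesis
        using uv a by (intro exI[of _ "[u, a4, v]"]) (simp add: defs)
    next
      case 3
      then show ?thesis
        using uv a by (intro exI[of _ "[u, a3, a0, a4, v]"]) (simp add: defs)
    next
      case 4
      then show ?thesis
        using uv a by (intro exI[of _ "[u, a4, v]"]) (simp add: defs)
    next
      case 5
      then show ?thesis
        using uv a by (intro exI[of _ "[u, a0, a4, v]"]) (simp add: defs)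
    next
      case 6
      then show ?thesis
        using uv a by (intro exI[of _ "[u, a0, v]"]) (simp add: defs)
    next
      case 7
      then show ?thesis
        \<comment> \<open>Edge colors 1, 2, 3, 0 and vertex colors 5, 6, 4: all seven occur here
          too.\<close>
        using uv a by (intro exI[of _ "[u, a0, a4, a1, v]"]) (simp add: defs)
    next
      case 8
      then show ?thesis
        using uv a by (intro exI[of _ "[u, a0, v]"]) (simp add: defs)
    next
      case 9
      then show ?thesis
        \<comment> \<open>Passing through \<open>a0\<close> alone would repeat color 2; the detour
          by \<open>a2\<close> gives 2, 0, 1.\<close>
        using uv a by (intro exI[of _ "[u, a0, a2, v]"]) (simp add: defs)
    qed
  qed
  show ?thesis
    unfolding total_rainbow_connected_def
  proof (intro ballI impI)
    fix u v assume uv: "u \<in> pverts G" "v \<in> pverts G" "u \<noteq> v"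
    show "\<exists>p. total_rainbow_path G (layer_coloring f) p \<and> hd p = u \<and> last p = v"
    proof (cases "f u \<le> f v")
      case True
      then show ?thesis using * uv by blast
    next
      case False
      then obtain p where "total_rainbow_path G (layer_coloring f) p" "hd p = v" "last p = u"
        using *[of v u] uv by auto
      then show ?thesis
        using total_rainbow_path_rev[OF sym]
        by (intro exI[of _ "rev p"]) (auto simp: hd_rev last_rev)
    qed
  qed
qed

section \<open>Consequences of a total-rainbow coloring\<close>

lemma trc_le_card:
  "total_rainbow_connected G c \<Longrightarrow> trc G \<le> card (c ` graph_elements G)"
  unfolding trc_def by (rule Least_le) blast

lemma (in pair_wf_digraph) vwalk_reachable:
  "vwalk p (with_proj G) \<Longrightarrow> hd p \<rightarrow>\<^sup>*\<^bsub>with_proj G\<^esub> last p"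
  by (induction p rule: vwalk_arcs.induct) (auto simp: vwalk_def intro: adj_reachable_trans)

text \<open>Rainbow paths are walks, so connectedness of the graph comes from the coloring
  itself.\<close>

lemma total_rainbow_connected_imp_connected:
  assumes "pair_wf_digraph G" and "pverts G \<noteq> {}" and "total_rainbow_connected G c"
  shows "Digraph_Component.connected (with_proj G)"
proof -
  interpret pair_wf_digraph G by fact
  have reach: "u \<rightarrow>\<^sup>*\<^bsub>with_proj G\<^esub> v" if uv: "u \<in> pverts G" "v \<in> pverts G" for u v
  proof (cases "u = v")
    case True
    then show ?thesis using uv by simp
  next
    case False
    then obtain p where "total_rainbow_path G c p" "hd p = u" "last p = v"
      using assms(3) uv unfolding total_rainbow_connected_def by auto
    then show ?thesis
      using vwalk_reachable[of p] unfolding total_rainbow_path_def vpath_def by simp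
  qed
  then show ?thesis
    unfolding connected_def using assms(2)
    by (intro strongly_connectedI) (auto intro: reachable_mk_symmetricI)
qed

section \<open>Distance layers in the complement\<close>

lemma pair_graph_graph_complement:
  assumes "pair_graph G"
  shows "pair_graph (graph_complement G)"
proof -
  interpret pair_graph G by fact
  have "parcs (graph_complement G) \<subseteq> pverts G \<times> pverts G"
    by (auto simp: graph_complement_def)
  then have "finite (parcs (graph_complement G))"
    using pair_finite_verts by (meson finite_SigmaI finite_subset)
  moreover have "sym (parcs G)" using pair_sym_arcs by (simp add: symmetric_def)
  ultimately show ?thesis
    using pair_finite_verts
    by unfold_locales (auto simp: graph_complement_def symmetric_def sym_def)
qed

lemma (in pair_wf_digraph) relpow_imp_awalk:
  assumes "(u, v) \<in> parcs G ^^ n" and "v \<in> pverts G"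
  shows "\<exists>p. awalk u p v \<and> length p = n"
  using assms(1)
proof (induction n arbitrary: u)
  case 0
  then show ?case using assms(2) by (auto simp: awalk_Nil_iff)
next
  case (Suc n)
  then obtain w where w: "(u, w) \<in> parcs G" "(w, v) \<in> parcs G ^^ n"
    by (meson relpow_Suc_D2)
  with Suc obtain p where "awalk w p v" "length p = n" by blast
  with w show ?case
    by (intro exI[of _ "(u, w) # p"]) (auto simp: awalk_Cons_iff)
qed

text \<open>\<open>graph_dist\<close> is an infimum of walk costs with unit weights. This turns a
  large distance into a lower bound on walk lengths.\<close>

lemma graph_dist_le_relpow:
  assumes "pair_wf_digraph G" and "(u, v) \<in> parcs G ^^ n" and "v \<in> pverts G"
  shows "graph_dist G u v \<le> ereal (real n)"
proof -
  interpret pair_wf_digraph G by fact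
  obtain p where p: "awalk u p v" "length p = n"
    using relpow_imp_awalk assms by blast
  have "awalk_cost (\<lambda>_. 1) p = real n"
    using p(2) by (simp add: awalk_cost_def sum_list_triv)
  then show ?thesis
    using min_cost_le_walk_cost[OF p(1), of "\<lambda>_. 1"] by (simp add: graph_dist_def)
qed

text \<open>Take the distance from \<open>x\<close> truncated at \<open>k\<close>. By
  \<open>far\<close>, \<open>y\<close> is at distance at least \<open>k\<close>, so no layer is
  empty.\<close>

lemma relpow_layering:
  fixes R :: "'a rel" and x y :: 'a
  assumes conn: "\<And>v. v \<in> V \<Longrightarrow> (x, v) \<in> R\<^sup>*"
    and R: "R \<subseteq> V \<times> V" and xy: "x \<in> V" "y \<in> V"
    and far: "\<And>n. (x, y) \<in> R ^^ n \<Longrightarrow> k \<le> n"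
  obtains f :: "'a \<Rightarrow> nat" where "\<And>v. f v \<le> k"
    and "\<And>v. v \<in> V \<Longrightarrow> f v = 0 \<Longrightarrow> 0 < k \<Longrightarrow> v = x"
    and "\<And>i. i \<le> k \<Longrightarrow> \<exists>v\<in>V. f v = i"
    and "\<And>u v. (u, v) \<in> R \<Longrightarrow> f v \<le> f u + 1"
proof -
  define d where "d v = (LEAST n. (x, v) \<in> R ^^ n)" for v
  have d: "(x, v) \<in> R ^^ d v" if "v \<in> V" for v
  proof -
    have "\<exists>n. (x, v) \<in> R ^^ n" using conn[OF that] by (simp add: rtrancl_power)
    then show ?thesis unfolding d_def by (rule LeastI_ex)
  qed
  have d_le: "d v \<le> n" if "(x, v) \<in> R ^^ n" for v n
    using that unfolding d_def by (rule Least_le)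
  have step: "d v \<le> d u + 1" if "(u, v) \<in> R" for u v
    using d[of u] d_le[of v "Suc (d u)"] that R by auto
  have attained: "\<exists>v\<in>V. d v = i" if "i \<le> d y" for i
    using that
  proof (induction rule: inc_induct)
    case base
    then show ?case using xy by blast
  next
    case (step n)
    then obtain v where v: "v \<in> V" "d v = Suc n" by blast
    \<comment> \<open>Descending from \<open>d y\<close>: \<open>w\<close> precedes \<open>v\<close>
      on a shortest walk, which forces \<open>d w = n\<close>.\<close>
    then obtain w where w: "(x, w) \<in> R ^^ n" "(w, v) \<in> R" using d[of v] by auto
    then have "d w \<le> n" "d v \<le> d w + 1" "w \<in> V"
      using d_le \<open>\<And>u v. (u, v) \<in> R \<Longrightarrow> d v \<le> d u + 1\<close> R by auto
    then show ?case using v by auto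
  qed
  have "k \<le> d y" using far d xy by blast
  show thesis
  proof (rule that[of "\<lambda>v. min k (d v)"])
    fix i assume "i \<le> k"
    then obtain v where "v \<in> V" "d v = i"
      using attained[of i] \<open>k \<le> d y\<close> by auto
    then show "\<exists>v\<in>V. min k (d v) = i"
      using \<open>i \<le> k\<close> by (intro bexI[of _ v]) auto
  next
    fix v assume "v \<in> V" "min k (d v) = 0" "0 < k"
    then show "v = x" using d[of v] by (auto simp: min_def split: if_splits)
  next
    fix u v assume "(u, v) \<in> R"
    then show "min k (d v) \<le> min k (d u) + 1" using step[of u v] by linarith
  qed simp
qed

theorem theorem4p4:
  fixes G :: "'a pair_pre_digraph"
  assumes "pair_graph G"
    and "Digraph_Component.connected (with_proj (graph_complement G))"
    and "graph_diam (graph_complement G) > 3"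
  shows "Digraph_Component.connected (with_proj G) \<and> trc G \<le> 7"
proof -
  interpret G: pair_graph G by fact
  let ?H = "graph_complement G"
  interpret H: pair_graph ?H using assms(1) by (rule pair_graph_graph_complement)
  have symG: "sym (parcs G)" using G.pair_sym_arcs by (simp add: symmetric_def)
  have V: "pverts ?H = pverts G" by (simp add: graph_complement_def)
  obtain x y where xy: "x \<in> pverts G" "y \<in> pverts G" "3 < graph_dist ?H x y"
    using assms(3) unfolding graph_diam_def V by (auto simp: less_SUP_iff)
  have far: "4 \<le> n" if "(x, y) \<in> parcs ?H ^^ n" for n
  proof -
    have "3 < ereal (real n)"
      using less_le_trans[OF xy(3) graph_dist_le_relpow[OF H.pair_wf_digraph_axioms that]] xy V
      by simp
    then show ?thesis by simp
  qed
  \<comment> \<open>The layering needs directed reachability; symmetry of the complement provides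
    it.\<close>
  have "strongly_connected (with_proj ?H)"
    using H.symmetric_connected_imp_strongly_connected assms(2) H.pair_sym_arcs by blast
  then have conn: "(x, v) \<in> (parcs ?H)\<^sup>*" if "v \<in> pverts G" for v
    using that xy V by (auto simp: strongly_connected_def H.reachable_conv)
  obtain f :: "'a \<Rightarrow> nat" where f: "\<And>v. f v \<le> 4"
      "\<And>v. v \<in> pverts G \<Longrightarrow> f v = 0 \<Longrightarrow> v = x"
      "\<And>i. i \<le> 4 \<Longrightarrow> \<exists>v\<in>pverts G. f v = i"
      "\<And>u v. (u, v) \<in> parcs ?H \<Longrightarrow> f v \<le> f u + 1"
    using relpow_layering[of "pverts G" x "parcs ?H" y 4] conn far xy
    by (auto simp: graph_complement_def)
  have trc: "total_rainbow_connected G (layer_coloring f)"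
  proof (rule layer_coloring_total_rainbow_connected[OF symG])
    fix u v assume "u \<in> pverts G" "v \<in> pverts G" "f u + 2 \<le> f v"
    then show "(u, v) \<in> parcs G"
      \<comment> \<open>Along a complement edge \<open>f\<close> rises by at most 1, so a rise of 2
        forces an edge of \<open>G\<close>.\<close>
      using f(4)[of u v] by (cases "u = v") (auto simp: graph_complement_def)
  next
    fix u v assume "u \<in> pverts G" "v \<in> pverts G" "f u = 0" "f v = 0"
    then show "u = v" using f(2) by metis
  qed (use f in auto)
  have "layer_coloring f ` graph_elements G \<subseteq> {..6}" using layer_coloring_le by auto
  then have "card (layer_coloring f ` graph_elements G) \<le> card {..6::nat}"
    by (intro card_mono) auto
  then have "trc G \<le> 7" using trc_le_card[OF trc] by simp
  moreover have "Digraph_Component.connected (with_proj G)"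
    using total_rainbow_connected_imp_connected[OF G.pair_wf_digraph_axioms _ trc] xy by auto
  ultimately show ?thesis by simp
qed

end
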